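(* Given an explicit Runge--Kutta method with coefficients $A\in\mathbb{R}^{s\times s}$, $b\in\mathbb{R}^s$, let $\mathcal{C}(A,b)$ denote its SSP coefficient, and let $R(z)=1+\sum_{k=1}^s\alpha_kz^k$ be its stability function. Then $$\mathcal{C}(A,\gamma b)\ge\mathcal{C}(A,b)\qquad\text{for } 0\le\gamma\le\gamma_*,$$ where $$\gamma_*=-\frac{1}{\sum_{k=1}^s\alpha_k(-\mathcal{C}(A,b))^k}=\frac{-1}{R(-\mathcal{C}(A,b))-1}\ge1.$$
   Context: A method with coefficients $(A,b)$ is explicit if $A$ is strictly lower triangular. Let $e\in\mathbb{R}^s$ be the vector with all entries equal to $1$. The stability function of a method $(A,b)$ is $R(z)=1+zb^T(I-zA)^{-1}e$, which for an explicit method is a polynomial $1+\sum_{k=1}^s\alpha_kz^k$. A method $(A,b)$ is absolutely monotonic at $z\in\mathbb{R}$ if all of the following hold, with inequalities understood entrywise: $A(I-zA)^{-1}\ge0$, $(I-zA)^{-1}e\ge0$, $b^T(I-zA)^{-1}\ge0$, and $R(z)\ge0$. The SSP coefficient (radius of absolute monotonicity) $\mathcal{C}(A,b)$ is the largest value $r\ge0$ such that the method $(A,b)$ is absolutely monotonic at $-r$. $(A,\gamma b)$ denotes the method with the same matrix $A$ and weights $\gamma b$. *)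

theory Defs
  imports "HOL-Analysis.Analysis"
begin

text \<open>
  A Runge--Kutta method with \<open>s\<close> stages is a pair \<open>(A, b)\<close> with \<open>A :: real^'s^'s\<close> and
  \<open>b :: real^'s\<close>, where \<open>s = CARD('s)\<close> and the linear order on \<open>'s\<close> is the order of the stages.
  The vector \<open>e\<close> of ones is \<open>vec 1\<close>, and the order \<open>\<le>\<close> on vectors and matrices is the library's
  componentwise order.
\<close>

definition explicit_rk :: "real^'s::{finite,linorder}^'s::{finite,linorder} \<Rightarrow> bool" where
  "explicit_rk A \<longleftrightarrow> (\<forall>i j. i \<le> j \<longrightarrow> A $ i $ j = 0)"

definition resolvent :: "real^'s^'s \<Rightarrow> real \<Rightarrow> real^'s^'s" where
  "resolvent A z = matrix_inv (mat 1 - z *\<^sub>R A)"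

definition stability_function :: "real^'s^'s \<Rightarrow> real^'s \<Rightarrow> real \<Rightarrow> real" where
  "stability_function A b z = 1 + z * (b \<bullet> (resolvent A z *v vec 1))"

text \<open>
  The first conjunct makes explicit that the inverse has to exist, since \<open>matrix_inv\<close> is
  unspecified on singular matrices. It always holds when \<open>A\<close> is strictly lower triangular.
\<close>
definition absolutely_monotonic_at :: "real^'s^'s \<Rightarrow> real^'s \<Rightarrow> real \<Rightarrow> bool" where
  "absolutely_monotonic_at A b z \<longleftrightarrow>
     invertible (mat 1 - z *\<^sub>R A) \<and>
     0 \<le> A ** resolvent A z \<and>
     0 \<le> resolvent A z *v vec 1 \<and>
     0 \<le> b v* resolvent A z \<and>
     0 \<le> stability_function A b z"

text \<open>
  The supremum is the largest element of the set whenever there is one. For explicit methods the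
  conditions are polynomial inequalities in \<open>r\<close>, so the set is closed and the supremum is attained
  if it is finite; it is \<open>\<infinity>\<close> if the set is unbounded, as for \<open>A = 0\<close>, \<open>b = 0\<close>. If no \<open>r \<ge> 0\<close> is
  admissible, the coefficient is \<open>0\<close>, the usual convention.
\<close>
definition ssp_coefficient :: "real^'s^'s \<Rightarrow> real^'s \<Rightarrow> ereal" where
  "ssp_coefficient A b =
     (let S = {r. 0 \<le> r \<and> absolutely_monotonic_at A b (- r)}
      in if S = {} then 0 else (SUP r\<in>S. ereal r))"

text \<open>
  \<open>-1 / x\<close> with value \<open>+\<infinity>\<close> at \<open>x = 0\<close>. It is applied to \<open>x = R (- C) - 1 \<le> 0\<close>, so
  \<open>+\<infinity>\<close> is the limiting value, whereas division on \<open>ereal\<close> would give \<open>-1 / 0 = -\<infinity>\<close>.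
\<close>
definition neg_reciprocal :: "real \<Rightarrow> ereal" where
  "neg_reciprocal x = (if x = 0 then \<infinity> else ereal (- 1 / x))"

text \<open>
  \<open>real_of_ereal\<close> only loses information for \<open>C = \<infinity>\<close>. For an explicit method this happens only if
  \<open>A = 0\<close> and \<open>b = 0\<close>; then \<open>R\<close> is constantly \<open>1\<close>, and \<open>\<gamma>\<^sub>*\<close> is \<open>\<infinity>\<close> whichever real number is
  substituted for \<open>C\<close>.
\<close>
definition gamma_star :: "real^'s^'s \<Rightarrow> real^'s \<Rightarrow> (nat \<Rightarrow> real) \<Rightarrow> ereal" where
  "gamma_star A b \<alpha> =
     neg_reciprocal (\<Sum>k=1..CARD('s). \<alpha> k * (- real_of_ereal (ssp_coefficient A b)) ^ k)"

end

theory Submission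
  imports Defs
begin

text \<open>
  For \<open>z \<le> 0\<close> the condition \<open>b\<^sup>T (I - zA)\<^sup>-\<^sup>1 \<ge> 0\<close> forces \<open>R(z) - 1 = z b\<^sup>T (I - zA)\<^sup>-\<^sup>1 e \<le> 0\<close>, and
  \<open>R(z) - 1\<close> is linear in the weights \<open>b\<close>. Replacing \<open>b\<close> by \<open>\<gamma> b\<close> with \<open>\<gamma> \<ge> 0\<close> preserves the three
  sign conditions that do not involve \<open>R\<close>, so the only condition at stake is
  \<open>1 + \<gamma> (R(z) - 1) \<ge> 0\<close>, which is \<open>\<gamma> \<le> -1 / (R(z) - 1)\<close>. At \<open>z = - C\<close> with \<open>C\<close> the SSP coefficient
  of \<open>(A, b)\<close> this is \<open>\<gamma> \<le> \<gamma>\<^sub>*\<close>, and \<open>0 \<le> R(- C) \<le> 1\<close> gives \<open>\<gamma>\<^sub>* \<ge> 1\<close>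
  (lemmas \<open>absolutely_monotonic_at_scaleR_weights\<close> and \<open>stability_function_le_1\<close>).

  This needs \<open>C\<close> to be attained when it is a finite supremum of admissible radii; if there are no
  admissible radii, then \<open>C = 0\<close> is a trivial lower bound and \<open>R(0) = 1\<close>. For an explicit method
  \<open>I - zA\<close> is invertible for every \<open>z\<close>, its inverse is continuous in \<open>z\<close> by Cramer's rule, and all
  the conditions are closed
  (lemma \<open>closed_absolutely_monotonic\<close>). If \<open>C = \<infinity>\<close>, then the polynomial \<open>R\<close> has values in \<open>[0, 1]\<close>
  on an unbounded set, so it is constant and the condition on \<open>R\<close> holds for every \<open>\<gamma>\<close>
  (lemma \<open>stability_function_eq_1_if_unbounded\<close>).
\<close>

section \<open>Continuity of the matrix inverse\<close>

lemma continuous_on_det: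
  fixes M :: "'a::topological_space \<Rightarrow> real^'n^'n"
  assumes "continuous_on S M"
  shows "continuous_on S (\<lambda>t. det (M t))"
  unfolding det_def by (intro continuous_intros assms)

lemma matrix_inv_right:
  fixes M :: "'a::semiring_1^'n^'m"
  assumes "invertible M"
  shows "M ** matrix_inv M = mat 1"
  using someI_ex[OF assms[unfolded invertible_def]] unfolding matrix_inv_def by blast

text \<open>
  By Cramer's rule the entries of \<open>M\<^sup>-\<^sup>1\<close> are quotients of determinants in the entries of \<open>M\<close>.
\<close>
lemma continuous_on_matrix_inv:
  fixes M :: "'a::topological_space \<Rightarrow> real^'n^'n"
  assumes cont: "continuous_on S M" and inv: "\<And>t. t \<in> S \<Longrightarrow> invertible (M t)"
  shows "continuous_on S (\<lambda>t. matrix_inv (M t))"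
proof -
  define N where "N = (\<lambda>t k l. (\<chi> i j. if j = k then axis l 1 $ i else M t $ i $ j) :: real^'n^'n)"
  have entry: "matrix_inv (M t) $ k $ l = det (N t k l) / det (M t)" if "t \<in> S" for t k l
  proof -
    have "M t *v (matrix_inv (M t) *v axis l 1) = axis l 1"
      by (simp add: matrix_vector_mul_assoc matrix_inv_right inv that)
    moreover have "det (M t) \<noteq> 0"
      using inv[OF that] by (simp add: invertible_det_nz)
    ultimately have "matrix_inv (M t) *v axis l 1 = (\<chi> k. det (N t k l) / det (M t))"
      unfolding N_def by (rule cramer[THEN iffD1, rotated])
    then show ?thesis
      by (simp add: matrix_vector_mul_component matrix_vector_mult_basis column_def vec_eq_iff)
  qed
  have contN: "continuous_on S (\<lambda>t. N t k l)" for k l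
    unfolding N_def
  proof (intro continuous_on_vec_lambda)
    fix i j
    show "continuous_on S (\<lambda>t. if j = k then axis l 1 $ i else M t $ i $ j)"
      by (cases "j = k") (auto intro!: continuous_intros cont)
  qed
  have "continuous_on S (\<lambda>t. (\<chi> k l. det (N t k l) / det (M t)) :: real^'n^'n)"
    by (intro continuous_on_vec_lambda continuous_on_divide continuous_on_det contN cont)
       (use inv in \<open>simp add: invertible_det_nz\<close>)
  then show ?thesis
    by (rule continuous_on_eq) (simp add: vec_eq_iff entry)
qed

section \<open>Attainment of the SSP coefficient for explicit methods\<close>

text \<open>
  Forward substitution: the first nonzero entry of a vector \<open>x\<close> with \<open>x = z A x\<close> would be a
  combination of earlier entries, which vanish.
\<close>
lemma explicit_rk_invertible:
  fixes A :: "real^'s::{finite,linorder}^'s::{finite,linorder}"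
  assumes "explicit_rk A"
  shows "invertible (mat 1 - z *\<^sub>R A)"
  unfolding invertible_left_inverse matrix_left_invertible_ker
proof (intro allI impI)
  fix x :: "real^'s::{finite,linorder}"
  assume "(mat 1 - z *\<^sub>R A) *v x = 0"
  then have fixpoint: "x = z *\<^sub>R (A *v x)"
    by (simp add: matrix_vector_mult_diff_rdistrib scaleR_matrix_vector_assoc)
  show "x = 0"
  proof (rule ccontr)
    assume "x \<noteq> 0"
    then have nonempty: "{i. x $ i \<noteq> 0} \<noteq> {}"
      by (auto simp: vec_eq_iff)
    define m where "m = Min {i. x $ i \<noteq> 0}"
    have "x $ m \<noteq> 0"
      using Min_in[OF _ nonempty] by (simp add: m_def)
    have before: "x $ j = 0" if "j < m" for j
    proof (rule ccontr)
      assume "x $ j \<noteq> 0"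
      then have "m \<le> j" unfolding m_def by (intro Min_le) auto
      with that show False by simp
    qed
    have terms: "A $ m $ j * x $ j = 0" for j
      using assms before[of j] by (cases "j < m") (auto simp: explicit_rk_def)
    have "(A *v x) $ m = 0"
      by (simp only: matrix_vector_mult_def vec_lambda_beta terms sum.neutral_const)
    then have "x $ m = 0"
      by (subst fixpoint) simp
    with \<open>x $ m \<noteq> 0\<close> show False ..
  qed
qed

lemma closed_absolutely_monotonic:
  fixes A :: "real^'s::{finite,linorder}^'s::{finite,linorder}"
  assumes "explicit_rk A"
  shows "closed {r. 0 \<le> r \<and> absolutely_monotonic_at A b (- r)}"
proof -
  have contR: "continuous_on UNIV (\<lambda>r. resolvent A (- r))"
    unfolding resolvent_def
    by (intro continuous_on_matrix_inv explicit_rk_invertible assms continuous_intros)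
  have inv: "invertible (mat 1 - (- r) *\<^sub>R A)" for r
    by (rule explicit_rk_invertible[OF assms])
  show ?thesis
    unfolding absolutely_monotonic_at_def stability_function_def less_eq_vec_def
      matrix_matrix_mult_def matrix_vector_mult_def vector_matrix_mult_def inner_vec_def
    by (simp only: inv simp_thms zero_index)
       (intro closed_Collect_conj closed_Collect_all closed_Collect_le continuous_intros contR)
qed

text \<open>
  Closedness turns a finite supremum into an admissible radius \<open>c\<close>, at which the conditions can be
  evaluated. In the first case, the convention for an empty admissible set, nothing is known about
  the signs, but any coefficient is at least \<open>0\<close>.
\<close>
lemma ssp_coefficient_cases [consumes 1, case_names none attained unbounded]:
  fixes A :: "real^'s::{finite,linorder}^'s::{finite,linorder}"
  assumes "explicit_rk A"
  obtains
    (none) "ssp_coefficient A b = 0"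
  | (attained) c where "ssp_coefficient A b = ereal c" "0 \<le> c" "absolutely_monotonic_at A b (- c)"
  | (unbounded) "ssp_coefficient A b = \<infinity>"
      "\<And>B. \<exists>r\<ge>B. 0 \<le> r \<and> absolutely_monotonic_at A b (- r)"
proof -
  define S where "S = {r. 0 \<le> r \<and> absolutely_monotonic_at A b (- r)}"
  have ssp: "ssp_coefficient A b = (if S = {} then 0 else (SUP r\<in>S. ereal r))"
    unfolding ssp_coefficient_def S_def Let_def by (rule refl)
  consider "S = {}" | "S \<noteq> {}" "bdd_above S" | "S \<noteq> {}" "\<not> bdd_above S"
    by metis
  then show thesis
  proof cases
    case 1
    show thesis by (rule none) (simp add: ssp 1)
  next
    case 2
    have mem: "Sup S \<in> S"
      using closed_contains_Sup[OF 2] closed_absolutely_monotonic[OF assms] by (simp add: S_def)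
    have "(SUP r\<in>S. ereal r) = ereal (Sup S)"
      by (rule antisym) (auto intro!: SUP_least SUP_upper mem cSup_upper 2)
    then have "ssp_coefficient A b = ereal (Sup S)"
      using ssp 2(1) by simp
    moreover have "0 \<le> Sup S \<and> absolutely_monotonic_at A b (- Sup S)"
      using mem unfolding S_def by (rule CollectD)
    ultimately show thesis
      using attained by blast
  next
    case 3
    have large: "\<exists>r\<in>S. B \<le> r" for B
      using 3(2) unfolding bdd_above_def by (meson linear)
    have "(SUP r\<in>S. ereal r) = \<infinity>"
    proof (rule ereal_top)
      fix B
      obtain r where "r \<in> S" "B \<le> r" using large by blast
      then show "ereal B \<le> (SUP r\<in>S. ereal r)"
        by (intro SUP_upper2[of r]) auto
    qed
    then have "ssp_coefficient A b = \<infinity>"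
      using ssp 3(1) by simp
    moreover have "\<exists>r\<ge>B. 0 \<le> r \<and> absolutely_monotonic_at A b (- r)" for B
      using large[of B] unfolding S_def by blast
    ultimately show thesis
      by (rule unbounded)
  qed
qed

lemma le_ssp_coefficient:
  assumes "0 \<le> r" "absolutely_monotonic_at A b (- r)"
  shows "ereal r \<le> ssp_coefficient A b"
  using assms unfolding ssp_coefficient_def Let_def by (auto intro!: SUP_upper)

lemma ssp_coefficient_nonneg: "0 \<le> ssp_coefficient A b"
proof (cases "\<exists>r\<ge>0. absolutely_monotonic_at A b (- r)")
  case True
  then obtain r where "0 \<le> r" "absolutely_monotonic_at A b (- r)" by blast
  from le_ssp_coefficient[OF this] \<open>0 \<le> r\<close> show ?thesis
    by (metis ereal_less_eq(5) order_trans)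
next
  case False
  then show ?thesis by (simp add: ssp_coefficient_def Let_def)
qed

section \<open>Scaling the weights\<close>

lemma stability_function_0 [simp]: "stability_function A b 0 = 1"
  by (simp add: stability_function_def)

lemma stability_function_scaleR_weights:
  "stability_function A (\<gamma> *\<^sub>R b) z = 1 + \<gamma> * (stability_function A b z - 1)"
  by (simp add: stability_function_def)

text \<open>
  Writing \<open>b\<^sup>T (I - zA)\<^sup>-\<^sup>1 e\<close> as \<open>(b\<^sup>T (I - zA)\<^sup>-\<^sup>1) e\<close> exhibits it as a sum of entries that are
  nonnegative by assumption.
\<close>
lemma stability_function_le_1:
  assumes "absolutely_monotonic_at A b z" "z \<le> 0"
  shows "stability_function A b z \<le> 1"
proof -
  have "0 \<le> (b v* resolvent A z) \<bullet> vec 1"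
    using assms(1)
    by (auto simp: absolutely_monotonic_at_def less_eq_vec_def inner_vec_def intro: sum_nonneg)
  then have "z * (b \<bullet> (resolvent A z *v vec 1)) \<le> 0"
    using assms(2) by (simp add: dot_lmul_matrix mult_nonpos_nonneg)
  then show ?thesis by (simp add: stability_function_def)
qed

lemma absolutely_monotonic_at_scaleR_weights:
  assumes "absolutely_monotonic_at A b z" "0 \<le> \<gamma>" "\<gamma> * (1 - stability_function A b z) \<le> 1"
  shows "absolutely_monotonic_at A (\<gamma> *\<^sub>R b) z"
proof -
  have "0 \<le> (\<gamma> *\<^sub>R b) v* resolvent A z"
    using assms(1,2)
    by (simp add: absolutely_monotonic_at_def scaleR_vector_matrix_assoc less_eq_vec_def)
  moreover have "0 \<le> stability_function A (\<gamma> *\<^sub>R b) z"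
    using assms(3) by (simp add: stability_function_scaleR_weights algebra_simps)
  ultimately show ?thesis
    using assms(1) by (simp add: absolutely_monotonic_at_def)
qed

text \<open>
  A nonconstant polynomial is unbounded along every sequence that tends to infinity in modulus,
  whereas absolute monotonicity at \<open>- r\<close> confines \<open>R(- r)\<close> to \<open>[0, 1]\<close>. So \<open>R\<close> is constant, with
  value \<open>R(0) = 1\<close>.
\<close>
lemma stability_function_eq_1_if_unbounded:
  assumes poly: "\<And>z. stability_function A b z = 1 + (\<Sum>k=1..n. \<alpha> k * z ^ k)"
    and unbounded: "\<And>B. \<exists>r\<ge>B. 0 \<le> r \<and> absolutely_monotonic_at A b (- r)"
  shows "stability_function A b z = 1"
proof -
  define c where "c k = (if k = 0 then 0 else \<alpha> k)" for k
  have c: "(\<Sum>k\<le>n. c k * x ^ k) = stability_function A b x - 1" for x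
  proof -
    have "(\<Sum>k\<le>n. c k * x ^ k) = (\<Sum>k=1..n. \<alpha> k * x ^ k)"
      by (rule sum.mono_neutral_cong_right) (auto simp: c_def)
    then show ?thesis by (simp add: poly)
  qed
  have "\<not> (\<exists>k. k \<noteq> 0 \<and> k \<le> n \<and> c k \<noteq> 0)"
  proof
    assume "\<exists>k. k \<noteq> 0 \<and> k \<le> n \<and> c k \<noteq> 0"
    from polyfun_extremal[OF this, of 2] obtain B
      where B: "\<And>x. B \<le> \<bar>x\<bar> \<Longrightarrow> 2 \<le> \<bar>stability_function A b x - 1\<bar>"
      by (auto simp: eventually_at_infinity c)
    from unbounded obtain r where r: "B \<le> r" "0 \<le> r" "absolutely_monotonic_at A b (- r)"
      by blast
    have "0 \<le> stability_function A b (- r)"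
      using r(3) by (simp add: absolutely_monotonic_at_def)
    moreover have "stability_function A b (- r) \<le> 1"
      using r by (intro stability_function_le_1) auto
    ultimately show False using B[of "- r"] r by auto
  qed
  then have "c k * z ^ k = 0" if "k \<le> n" for k
    using that by (cases "k = 0") (auto simp: c_def)
  then have "(\<Sum>k\<le>n. c k * z ^ k) = 0"
    by (intro sum.neutral) auto
  then show ?thesis by (simp add: c)
qed

section \<open>The range of admissible scalings\<close>

lemma one_le_neg_reciprocal:
  assumes "- 1 \<le> x" "x \<le> 0"
  shows "1 \<le> neg_reciprocal x"
  using assms by (auto simp: neg_reciprocal_def field_simps)

lemma mult_le_1_if_le_neg_reciprocal:
  assumes "ereal \<gamma> \<le> neg_reciprocal x" "x \<le> 0"
  shows "\<gamma> * (- x) \<le> 1"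
  using assms by (auto simp: neg_reciprocal_def field_simps split: if_splits)

theorem theorem9:
  fixes A :: "real^'s::{finite,linorder}^'s::{finite,linorder}" and b :: "real^'s::{finite,linorder}" and \<alpha> :: "nat \<Rightarrow> real"
  assumes "explicit_rk A"
    and "\<forall>z. stability_function A b z = 1 + (\<Sum>k=1..CARD('s). \<alpha> k * z ^ k)"
  shows "(\<forall>\<gamma>::real. 0 \<le> \<gamma> \<and> ereal \<gamma> \<le> gamma_star A b \<alpha> \<longrightarrow>
            ssp_coefficient A (\<gamma> *\<^sub>R b) \<ge> ssp_coefficient A b) \<and>
         gamma_star A b \<alpha> =
           neg_reciprocal (stability_function A b (- real_of_ereal (ssp_coefficient A b)) - 1) \<and>
         gamma_star A b \<alpha> \<ge> 1"
proof -
  define R where "R = stability_function A b (- real_of_ereal (ssp_coefficient A b))"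
  have gamma_star: "gamma_star A b \<alpha> = neg_reciprocal (R - 1)"
    by (simp add: gamma_star_def R_def assms(2)[rule_format])
  have R: "0 \<le> R \<and> R \<le> 1"
    using assms(1)
  proof (cases rule: ssp_coefficient_cases[where b = b])
    case (attained c)
    then show ?thesis
      using stability_function_le_1[of A b "- c"] by (simp add: R_def absolutely_monotonic_at_def)
  qed (simp_all add: R_def)
  have "ssp_coefficient A b \<le> ssp_coefficient A (\<gamma> *\<^sub>R b)"
    if \<gamma>: "0 \<le> \<gamma>" "ereal \<gamma> \<le> gamma_star A b \<alpha>" for \<gamma>
    using assms(1)
  proof (cases rule: ssp_coefficient_cases[where b = b])
    case none
    then show ?thesis by (simp add: ssp_coefficient_nonneg)
  next
    case (attained c)
    have "\<gamma> * (1 - stability_function A b (- c)) \<le> 1"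
      using mult_le_1_if_le_neg_reciprocal[of \<gamma> "R - 1"] \<gamma>(2) R attained(1)
      by (simp add: gamma_star R_def)
    then have "absolutely_monotonic_at A (\<gamma> *\<^sub>R b) (- c)"
      using absolutely_monotonic_at_scaleR_weights attained(3) \<gamma>(1) by blast
    from le_ssp_coefficient[OF attained(2) this] show ?thesis
      by (simp add: attained(1))
  next
    case unbounded
    have const: "stability_function A b z = 1" for z
      using stability_function_eq_1_if_unbounded[OF assms(2)[rule_format] unbounded(2)] .
    have "ereal B \<le> ssp_coefficient A (\<gamma> *\<^sub>R b)" for B
    proof -
      obtain r where r: "B \<le> r" "0 \<le> r" "absolutely_monotonic_at A b (- r)"
        using unbounded(2) by blast
      have "absolutely_monotonic_at A (\<gamma> *\<^sub>R b) (- r)"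
        using r(3) \<gamma>(1) by (rule absolutely_monotonic_at_scaleR_weights) (simp add: const)
      from le_ssp_coefficient[OF r(2) this] r(1) show ?thesis
        by (meson ereal_less_eq(3) order_trans)
    qed
    then have "ssp_coefficient A (\<gamma> *\<^sub>R b) = \<infinity>"
      by (rule ereal_top)
    then show ?thesis
      by simp
  qed
  moreover have "1 \<le> gamma_star A b \<alpha>"
    unfolding gamma_star using R by (intro one_le_neg_reciprocal) auto
  ultimately show ?thesis
    using gamma_star by (simp add: R_def)
qed

end
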